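(* Let $\mathfrak F$ be a countable field which is a subfield of $\mathbb R$ or $\mathbb C$, let $E$ be an $\mathfrak F$-vector space with a countably infinite basis $(e_n)_{n\in\mathbb N}$, and let $\|\cdot\|$ be a norm on $E$ taking values in $\mathfrak F$. Suppose $\mathbb A\subseteq E^\infty$ is strategically Ramsey and that for some sequence $\Delta=(\delta_i)_{i\in\mathbb N}$ of strictly positive real numbers the set $\mathrm{Int}_\Delta(\mathbb A)$ is large. Then there is an infinite-dimensional block subspace $X\subseteq E$ such that player II has a strategy in Gowers' game $G_X$ to play in $\mathbb A$.
   Context: For $x=\sum a_ne_n\in E$, $\operatorname{supp}x=\{n: a_n\neq0\}$. For non-zero $x,y\in E$, $x<y$ means $n<m$ for all $n\in\operatorname{supp}x$, $m\in\operatorname{supp}y$; for $k\in\mathbb N$, $k<x$ means $k<n$ for all $n\in\operatorname{supp}x$. A (finite, possibly empty, or infinite) sequence $(x_0,x_1,\ldots)$ of non-zero vectors is a block sequence if $x_n<x_{n+1}$ for all $n$. An (infinite-dimensional) block subspace is a subspace spanned by an infinite block sequence. For an infinite-dimensional block subspace $X\subseteq E$, $\mathfrak B(X)$ is the set of infinite block sequences $(x_i)$ of vectors in $X$ with $\|x_i\|\le1$ for all $i$. A set $\mathbb B\subseteq E^\infty=E^{\mathbb N}$ is large if $\mathbb B\cap\mathfrak B(X)\neq\emptyset$ for every infinite-dimensional block subspace $X\subseteq E$. Also $$\mathrm{Int}_\Delta(\mathbb B)=\{(x_i)\in E^\infty : \forall (z_i)\in E^\infty\ (\forall i\ \|x_i-z_i\|<\delta_i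 \Rightarrow (z_i)\in\mathbb B)\}.$$ Let $X\subseteq E$ be an infinite-dimensional block subspace and $\vec x$ a finite block sequence. Gowers' game $G_X(\vec x)$: players I and II alternate, I beginning. In round $i$, I plays an infinite-dimensional block subspace $Y_i\subseteq X$, then II plays a non-zero vector $x_i\in Y_i$, subject to $x_0<x_1<x_2<\cdots$. The outcome is the concatenation $\vec x{}^\frown(x_0,x_1,x_2,\ldots)$. $G_X$ is $G_X(\emptyset)$. Infinite asymptotic game $F_X(\vec x)$: I and II alternate, I beginning. In round $i$, I plays a natural number $n_i$, then II plays a non-zero vector $x_i\in X$ with $n_i<x_i$, subject to $n_0<n_1<\cdots$ and $x_0<x_1<\cdots$. The outcome is $\vec x{}^\frown(x_0,x_1,x_2,\ldots)$. A player "has a strategy to play in" a set $\mathbb A\subseteq E^\infty$ if he has a strategy ensuring that the outcome lies in $\mathbb A$. A set $\mathbb A\subseteq E^\infty$ is strategically Ramsey if for every infinite-dimensional block subspace $V\subseteq E$ and every finite block sequence $\vec z$ there is an infinite-dimensional block subspace $W\subseteq V$ such that either II has a strategy in $G_W(\vec z)$ to play in $\mathbb A$, or I has a strategy in $F_W(\vec z)$ to play in $E^\infty\setminus\mathbb A$. *)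

theory Defs
  imports Complex_Main "HOL-Library.Countable_Set" "HOL-Library.Omega_Words_Fun"
begin

text \<open>
  The scalar field is a type \<open>'f\<close> together with a field embedding \<open>emb\<close> into the complex numbers,
  so that \<open>range emb\<close> is a subfield of the complex numbers; subfields of the reals are the case
  \<open>range emb \<subseteq> \<real>\<close>. The modulus of a scalar \<open>c\<close> is \<open>cmod (emb c)\<close>.
\<close>

locale normed_space_with_basis = vector_space scale
  for scale :: "'f::field \<Rightarrow> 'e::ab_group_add \<Rightarrow> 'e" (infixr \<open>*s\<close> 75) +
  fixes emb :: "'f \<Rightarrow> complex"
    and e :: "nat \<Rightarrow> 'e"
    and nrm :: "'e \<Rightarrow> real"
  assumes countable_field: "countable (UNIV :: 'f set)"
    and emb_one: "emb 1 = 1"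
    and emb_add: "emb (a + b) = emb a + emb b"
    and emb_mult: "emb (a * b) = emb a * emb b"
    and basis_inj: "inj e"
    and basis_independent: "independent (range e)"
    and basis_span: "span (range e) = UNIV"
    and nrm_eq_zero: "nrm x = 0 \<longleftrightarrow> x = 0"
    and nrm_triangle: "nrm (x + y) \<le> nrm x + nrm y"
    and nrm_scale: "nrm (c *s x) = cmod (emb c) * nrm x"
    and nrm_in_field: "complex_of_real (nrm x) \<in> range emb"
begin

definition supp :: "'e \<Rightarrow> nat set" where
  "supp x = {n. representation (range e) x (e n) \<noteq> 0}"

definition precedes :: "'e \<Rightarrow> 'e \<Rightarrow> bool" where
  "precedes x y \<longleftrightarrow> (\<forall>n\<in>supp x. \<forall>m\<in>supp y. n < m)"

definition nat_precedes :: "nat \<Rightarrow> 'e \<Rightarrow> bool" where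
  "nat_precedes k x \<longleftrightarrow> (\<forall>n\<in>supp x. k < n)"

definition fin_block_seq :: "'e list \<Rightarrow> bool" where
  "fin_block_seq xs \<longleftrightarrow> (\<forall>i<length xs. xs ! i \<noteq> 0) \<and>
     (\<forall>i. Suc i < length xs \<longrightarrow> precedes (xs ! i) (xs ! Suc i))"

definition inf_block_seq :: "(nat \<Rightarrow> 'e) \<Rightarrow> bool" where
  "inf_block_seq x \<longleftrightarrow> (\<forall>i. x i \<noteq> 0) \<and> (\<forall>i. precedes (x i) (x (Suc i)))"

definition block_subspace :: "'e set \<Rightarrow> bool" where
  "block_subspace X \<longleftrightarrow> (\<exists>x. inf_block_seq x \<and> X = span (range x))"

definition unit_block_seqs :: "'e set \<Rightarrow> (nat \<Rightarrow> 'e) set" where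
  "unit_block_seqs X = {x. inf_block_seq x \<and> (\<forall>i. x i \<in> X) \<and> (\<forall>i. nrm (x i) \<le> 1)}"

definition large :: "(nat \<Rightarrow> 'e) set \<Rightarrow> bool" where
  "large B \<longleftrightarrow> (\<forall>X. block_subspace X \<longrightarrow> B \<inter> unit_block_seqs X \<noteq> {})"

definition Int_Delta :: "(nat \<Rightarrow> real) \<Rightarrow> (nat \<Rightarrow> 'e) set \<Rightarrow> (nat \<Rightarrow> 'e) set" where
  "Int_Delta \<delta> B = {x. \<forall>z. (\<forall>i. nrm (x i - z i) < \<delta> i) \<longrightarrow> z \<in> B}"

text \<open>
  A strategy is a function of the opponent's moves so far, the player's own earlier moves being
  determined by these. For II in Gowers' game the argument is \<open>[Y\<^sub>0, \<dots>, Y\<^sub>i]\<close>, for I in the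
  asymptotic game it is \<open>[x\<^sub>0, \<dots>, x\<^sub>i\<^sub>-\<^sub>1]\<close>. The strategy has to produce legal moves whenever the opponent
  does; every legal finite position extends to an infinite run in which the opponent plays
  legally, so it suffices to quantify over infinite sequences of opponent's moves.
\<close>

definition II_strategy_Gowers :: "'e set \<Rightarrow> 'e list \<Rightarrow> (nat \<Rightarrow> 'e) set \<Rightarrow> bool" where
  "II_strategy_Gowers X xs A \<longleftrightarrow>
     (\<exists>\<sigma> :: 'e set list \<Rightarrow> 'e.
        \<forall>Y. (\<forall>i. block_subspace (Y i) \<and> Y i \<subseteq> X) \<longrightarrow>
          (let x = (\<lambda>i. \<sigma> (map Y [0..<Suc i]))
           in (\<forall>i. x i \<in> Y i \<and> x i \<noteq> 0 \<and> precedes (x i) (x (Suc i))) \<and> xs \<frown> x \<in> A))"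

definition I_strategy_asymptotic :: "'e set \<Rightarrow> 'e list \<Rightarrow> (nat \<Rightarrow> 'e) set \<Rightarrow> bool" where
  "I_strategy_asymptotic X xs A \<longleftrightarrow>
     (\<exists>\<tau> :: 'e list \<Rightarrow> nat.
        \<forall>x. let n = (\<lambda>i. \<tau> (map x [0..<i]))
          in (\<forall>i. x i \<in> X \<and> x i \<noteq> 0 \<and> nat_precedes (n i) (x i) \<and> precedes (x i) (x (Suc i))) \<longrightarrow>
             (\<forall>i. n i < n (Suc i)) \<and> xs \<frown> x \<in> A)"

definition strategically_Ramsey :: "(nat \<Rightarrow> 'e) set \<Rightarrow> bool" where
  "strategically_Ramsey A \<longleftrightarrow>
     (\<forall>V zs. block_subspace V \<and> fin_block_seq zs \<longrightarrow>
        (\<exists>W. block_subspace W \<and> W \<subseteq> V \<and>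
           (II_strategy_Gowers W zs A \<or> I_strategy_asymptotic W zs (UNIV - A))))"

end

end

theory Submission
  imports Defs "HOL-Analysis.Topology_Euclidean_Space"
begin

text \<open>
  Apply the strategic Ramsey property to the whole space. If II has no winning strategy, I has a
  strategy \<open>\<tau>\<close> in the asymptotic game on some \<open>W\<close> to play in the complement of \<open>A\<close>. Bounded sets in
  finite-dimensional subspaces are totally bounded, so the vectors of \<open>W\<close> of norm at most 1 with a
  given support have a finite \<open>\<delta> i\<close>-net consisting of vectors with the same support. Hence only
  finitely many positions made of net vectors live below a given index, and one can pass to a
  subspace \<open>X\<close> of \<open>W\<close> so sparse that \<open>\<tau>\<close> never asks for more than the gaps in \<open>X\<close> already provide. By
  largeness some block sequence of \<open>X\<close> lies in \<open>Int_Delta \<delta> A\<close>; replacing its terms by net vectors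
  gives a sequence in \<open>A\<close> that is also an outcome of \<open>\<tau>\<close>, a contradiction.
\<close>

context normed_space_with_basis
begin

no_notation vector_scalar_mult (infixl \<open>*s\<close> 70)

section \<open>Elementary rules for the embedding and the norm\<close>

lemma emb_zero [simp]: "emb 0 = 0"
  using emb_add[of 0 0] by simp

lemma emb_minus: "emb (- a) = - emb a"
  using emb_add[of a "- a"] by (simp add: eq_neg_iff_add_eq_0 add.commute)

lemma emb_diff: "emb (a - b) = emb a - emb b"
  using emb_add[of a "- b"] by (simp add: emb_minus)

lemma nrm_zero [simp]: "nrm 0 = 0"
  by (simp add: nrm_eq_zero)

lemma nrm_minus: "nrm (- x) = nrm x"
  using nrm_scale[of "- 1" x] by (simp add: emb_minus emb_one)

lemma nrm_diff_triangle: "nrm (x - y) \<le> nrm x + nrm y"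
  using nrm_triangle[of x "- y"] by (simp add: nrm_minus)

lemma nrm_nonneg [simp]: "0 \<le> nrm x"
  using nrm_diff_triangle[of x x] by simp

lemma nrm_minus_commute: "nrm (x - y) = nrm (y - x)"
  using nrm_minus[of "x - y"] by simp

subsection \<open>Total boundedness in finite dimension\<close>

text \<open>Bounded sets of complex numbers have compact closure. The image of the field need not be
  closed, but balls centred at its points already cover the closure, so a finite subcover has
  scalars as centres.\<close>

lemma finite_scalar_net:
  assumes "\<eta> > 0"
  shows "\<exists>C. finite C \<and> (\<forall>c. cmod (emb c) \<le> R \<longrightarrow> (\<exists>c'\<in>C. cmod (emb (c - c')) < \<eta>))"
proof -
  define S where "S = {c. cmod (emb c) \<le> R}"
  have "bounded (emb ` S)"
    by (rule boundedI[of _ R]) (auto simp: S_def)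
  then have "compact (closure (emb ` S))"
    by (simp add: compact_closure)
  moreover have "closure (emb ` S) \<subseteq> (\<Union>c\<in>S. ball (emb c) \<eta>)"
    using assms by (auto simp: closure_approachable)
  ultimately obtain C where C: "C \<subseteq> S" "finite C" "closure (emb ` S) \<subseteq> (\<Union>c\<in>C. ball (emb c) \<eta>)"
    using compactE_image[of "closure (emb ` S)" S "\<lambda>c. ball (emb c) \<eta>"] by auto
  have "\<exists>c'\<in>C. cmod (emb (c - c')) < \<eta>" if "cmod (emb c) \<le> R" for c
  proof -
    have "emb c \<in> closure (emb ` S)"
      using that closure_subset by (force simp: S_def)
    then obtain c' where "c' \<in> C" "dist (emb c') (emb c) < \<eta>"
      using C by auto
    then show ?thesis
      by (auto simp: emb_diff dist_norm norm_minus_commute)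
  qed
  with C(2) show ?thesis
    by blast
qed

text \<open>Induction on \<open>S\<close>; \<open>r\<close> and \<open>\<epsilon>\<close> vary
  because the step enlarges the radius and halves the precision. The case split asks whether the new
  generator \<open>v\<close> keeps a positive distance from \<open>span S\<close>. If so, that
  distance bounds the coefficient of \<open>v\<close> in a vector of bounded norm.\<close>

lemma finite_net_span:
  assumes "finite S" "\<epsilon> > 0"
  shows "\<exists>N. finite N \<and> (\<forall>x\<in>span S. nrm x \<le> r \<longrightarrow> (\<exists>y\<in>N. nrm (x - y) < \<epsilon>))"
  using assms
proof (induction S arbitrary: r \<epsilon> rule: finite_induct)
  case empty
  then show ?case
    by (intro exI[of _ "{0}"]) auto
next
  case (insert v S)
  show ?case
  proof (cases "\<exists>d>0. \<forall>u\<in>span S. d \<le> nrm (v + u)")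
    case True
    then obtain d where d: "d > 0" "\<And>u. u \<in> span S \<Longrightarrow> d \<le> nrm (v + u)"
      by blast
    \<comment> \<open>An error below \<open>\<eta>\<close> in the coefficient of \<open>v\<close>
      costs at most \<open>\<epsilon> / 2\<close>; the added 1 makes the denominator visibly
      positive.\<close>
    define \<eta> where "\<eta> = \<epsilon> / (2 * (nrm v + 1))"
    have pos: "nrm v + 1 > 0"
      using nrm_nonneg[of v] by linarith
    then have "\<eta> > 0"
      using insert.prems by (simp add: \<eta>_def)
    then obtain C where C: "finite C"
      "\<And>c. cmod (emb c) \<le> r / d \<Longrightarrow> \<exists>c'\<in>C. cmod (emb (c - c')) < \<eta>"
      using finite_scalar_net[of \<eta> "r / d"] by blast
    \<comment> \<open>The radius bounds \<open>x - k *s v\<close> when \<open>nrm x \<le> r\<close>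
      and \<open>k\<close> has modulus at most \<open>r / d\<close>.\<close>
    obtain N where N: "finite N"
      "\<And>x. x \<in> span S \<Longrightarrow> nrm x \<le> r + r / d * nrm v \<Longrightarrow> \<exists>y\<in>N. nrm (x - y) < \<epsilon> / 2"
      using insert.IH[of "\<epsilon> / 2" "r + r / d * nrm v"] insert.prems by auto
    have "\<exists>y\<in>(\<lambda>(c, y). c *s v + y) ` (C \<times> N). nrm (x - y) < \<epsilon>"
      if x: "x \<in> span (insert v S)" "nrm x \<le> r" for x
    proof -
      obtain k where k: "x - k *s v \<in> span S"
        using x(1) by (auto simp: span_breakdown_eq)
      define u where "u = x - k *s v"
      have xu: "x = k *s v + u"
        by (simp add: u_def)
      have kr: "cmod (emb k) \<le> r / d"
      proof (cases "k = 0")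
        case True
        then show ?thesis
          using order_trans[OF nrm_nonneg x(2)] d(1) by simp
      next
        case False
        \<comment> \<open>Factoring out \<open>k\<close> leaves \<open>v\<close> plus an element of
          \<open>span S\<close>, to which the lower bound \<open>d\<close> applies.\<close>
        then have "x = k *s (v + inverse k *s u)"
          by (simp add: xu scale_right_distrib)
        then have "nrm x = cmod (emb k) * nrm (v + inverse k *s u)"
          by (metis nrm_scale)
        moreover have "d \<le> nrm (v + inverse k *s u)"
          using k by (intro d(2) span_scale) (simp add: u_def)
        ultimately have "cmod (emb k) * d \<le> nrm x"
          by (simp add: mult_left_mono)
        then show ?thesis
          using x(2) d(1) by (simp add: pos_le_divide_eq)
      qed
      then obtain c where c: "c \<in> C" "cmod (emb (k - c)) < \<eta>"
        using C(2) by blast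
      have "nrm u \<le> nrm x + cmod (emb k) * nrm v"
        using nrm_diff_triangle[of x "k *s v"] by (simp add: u_def nrm_scale)
      also have "\<dots> \<le> r + r / d * nrm v"
        using kr x(2) by (intro add_mono mult_right_mono) auto
      finally obtain y where y: "y \<in> N" "nrm (u - y) < \<epsilon> / 2"
        using N(2) k by (auto simp: u_def)
      have "x - (c *s v + y) = (k - c) *s v + (u - y)"
        by (simp add: xu scale_left_diff_distrib)
      then have "nrm (x - (c *s v + y)) \<le> cmod (emb (k - c)) * nrm v + nrm (u - y)"
        by (metis nrm_scale nrm_triangle)
      also have "cmod (emb (k - c)) * nrm v \<le> \<eta> * (nrm v + 1)"
        using c(2) \<open>\<eta> > 0\<close> by (intro mult_mono) auto
      also have "\<eta> * (nrm v + 1) = \<epsilon> / 2"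
        using pos by (simp add: \<eta>_def nonzero_divide_eq_eq)
      finally have "nrm (x - (c *s v + y)) < \<epsilon>"
        using y(2) by simp
      then show ?thesis
        using c(1) y(1) by force
    qed
    moreover have "finite ((\<lambda>(c, y). c *s v + y) ` (C \<times> N))"
      using C(1) N(1) by simp
    ultimately show ?thesis
      by blast
  next
    txt \<open>Here \<open>span S\<close> is dense in \<open>span (insert v S)\<close>. As \<open>'f\<close> need not be complete, this is not ruled out a priori.\<close>
    case False
    then have dense: "\<exists>u\<in>span S. nrm (v + u) < d" if "d > 0" for d
      using that by (auto simp: not_le)
    obtain N where N: "finite N"
      "\<And>x. x \<in> span S \<Longrightarrow> nrm x \<le> r + \<epsilon> / 2 \<Longrightarrow> \<exists>y\<in>N. nrm (x - y) < \<epsilon> / 2"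
      using insert.IH[of "\<epsilon> / 2" "r + \<epsilon> / 2"] insert.prems by auto
    have "\<exists>y\<in>N. nrm (x - y) < \<epsilon>" if x: "x \<in> span (insert v S)" "nrm x \<le> r" for x
    proof -
      obtain k where k: "x - k *s v \<in> span S"
        using x(1) by (auto simp: span_breakdown_eq)
      have pos: "cmod (emb k) + 1 > 0"
        using norm_ge_zero[of "emb k"] by linarith
      then obtain u where u: "u \<in> span S" "nrm (v + u) < \<epsilon> / (2 * (cmod (emb k) + 1))"
        using dense[of "\<epsilon> / (2 * (cmod (emb k) + 1))"] insert.prems by auto
      \<comment> \<open>Subtracting \<open>k *s (v + u)\<close> cancels the \<open>v\<close>-part
        but moves \<open>x\<close> by at most \<open>\<epsilon> / 2\<close>, so the net of
        \<open>span S\<close> serves for \<open>x\<close> as well.\<close>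
      define x' where "x' = x - k *s (v + u)"
      have "x' = (x - k *s v) - k *s u"
        by (simp add: x'_def scale_right_distrib)
      then have x'_span: "x' \<in> span S"
        using k u(1) by (simp add: span_diff span_scale)
      have "cmod (emb k) * nrm (v + u) \<le> (cmod (emb k) + 1) * (\<epsilon> / (2 * (cmod (emb k) + 1)))"
        using u(2) by (intro mult_mono) auto
      also have "\<dots> = \<epsilon> / 2"
        using pos by (simp add: nonzero_divide_eq_eq)
      finally have small: "nrm (k *s (v + u)) \<le> \<epsilon> / 2"
        by (simp add: nrm_scale)
      then have "nrm x' \<le> r + \<epsilon> / 2"
        using nrm_diff_triangle[of x "k *s (v + u)"] x(2) by (simp add: x'_def)
      then obtain y where y: "y \<in> N" "nrm (x' - y) < \<epsilon> / 2"
        using N(2) x'_span by blast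
      have "x - y = k *s (v + u) + (x' - y)"
        by (simp add: x'_def)
      then have "nrm (x - y) \<le> nrm (k *s (v + u)) + nrm (x' - y)"
        by (metis nrm_triangle)
      then show ?thesis
        using y small by force
    qed
    then show ?thesis
      using N(1) by blast
  qed
qed

text \<open>Net points of the span may lie outside \<open>D\<close>. Each one that is within
  \<open>\<epsilon> / 2\<close> of some point of \<open>D\<close> is replaced by such a point, and
  the two errors add up to less than \<open>\<epsilon>\<close>.\<close>

lemma finite_net_subset:
  assumes "finite S" "\<epsilon> > 0" "D \<subseteq> span S" "\<And>x. x \<in> D \<Longrightarrow> nrm x \<le> r"
  shows "\<exists>N\<subseteq>D. finite N \<and> (\<forall>x\<in>D. \<exists>y\<in>N. nrm (x - y) < \<epsilon>)"
proof -
  obtain N where N: "finite N" "\<And>x. x \<in> span S \<Longrightarrow> nrm x \<le> r \<Longrightarrow> \<exists>y\<in>N. nrm (x - y) < \<epsilon> / 2"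
    using finite_net_span[of S "\<epsilon> / 2" r] assms(1,2) by auto
  define near where "near y x \<longleftrightarrow> x \<in> D \<and> nrm (x - y) < \<epsilon> / 2" for y x
  define N' where "N' = (\<lambda>y. SOME x. near y x) ` {y \<in> N. \<exists>x. near y x}"
  have near_some: "near y (SOME x. near y x)" if "near y x" for x y
    using that by (rule someI)
  have "\<exists>y\<in>N'. nrm (x - y) < \<epsilon>" if xD: "x \<in> D" for x
  proof -
    obtain y where y: "y \<in> N" "near y x"
      using N(2)[of x] assms(3,4) xD unfolding near_def by blast
    define x' where "x' = (SOME x. near y x)"
    have "near y x'"
      using y(2) near_some by (simp add: x'_def)
    then have "nrm (x - y) + nrm (y - x') < \<epsilon>"
      using y(2) nrm_minus_commute[of y x'] by (simp add: near_def)
    then have "nrm (x - x') < \<epsilon>"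
      using nrm_triangle[of "x - y" "y - x'"] by simp
    then show ?thesis
      using y by (auto simp: N'_def x'_def)
  qed
  moreover have "N' \<subseteq> D"
    using near_some by (auto simp: N'_def near_def)
  moreover have "finite N'"
    using N(1) by (simp add: N'_def)
  ultimately show ?thesis
    by blast
qed

subsection \<open>Supports and block sequences\<close>

abbreviation coef :: "'e \<Rightarrow> nat \<Rightarrow> 'f" where
  "coef x n \<equiv> representation (range e) x (e n)"

lemma coef_add: "coef (x + y) n = coef x n + coef y n"
  by (simp add: representation_add basis_independent basis_span)

lemma coef_scale: "coef (c *s x) n = c * coef x n"
  by (simp add: representation_scale basis_independent basis_span)

lemma supp_iff: "n \<in> supp x \<longleftrightarrow> coef x n \<noteq> 0"
  by (simp add: supp_def)

lemma finite_supp [simp]: "finite (supp x)"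
proof -
  have "finite (e -` {b. representation (range e) x b \<noteq> 0})"
    using finite_representation basis_inj by (intro finite_vimageI)
  then show ?thesis
    by (simp add: supp_def vimage_def)
qed

lemma in_span_supp: "x \<in> span (e ` supp x)"
proof -
  have "x = (\<Sum>b | representation (range e) x b \<noteq> 0. representation (range e) x b *s b)"
    using sum_nonzero_representation_eq[of "range e" x] basis_independent basis_span by simp
  moreover have "\<dots> \<in> span (e ` supp x)"
  proof (intro span_sum span_scale span_base)
    fix b
    assume b: "b \<in> {b. representation (range e) x b \<noteq> 0}"
    then have "b \<in> range e"
      using representation_ne_zero by blast
    with b show "b \<in> e ` supp x"
      by (auto simp: supp_def)
  qed
  ultimately show ?thesis
    by simp
qed

lemma supp_empty_iff [simp]: "supp x = {} \<longleftrightarrow> x = 0"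
proof
  assume "supp x = {}"
  then show "x = 0"
    using in_span_supp[of x] by simp
qed (simp add: supp_def representation_zero)

lemma precedes_trans:
  assumes "precedes x y" "precedes y z" "y \<noteq> 0"
  shows "precedes x z"
proof -
  obtain k where "k \<in> supp y"
    using assms(3) supp_empty_iff by blast
  then show ?thesis
    using assms(1,2) unfolding precedes_def by (meson less_trans)
qed

lemma inf_block_seq_precedes:
  assumes "inf_block_seq x" "i < j"
  shows "precedes (x i) (x j)"
  using assms(2)
proof (induction j rule: less_Suc_induct)
  case (1 i)
  then show ?case
    using assms(1) by (simp add: inf_block_seq_def)
next
  case (2 i j k)
  then show ?case
    using assms(1) precedes_trans[of "x i" "x j" "x k"] by (simp add: inf_block_seq_def)
qed

lemma inf_block_seq_index_le:
  assumes "inf_block_seq x" "n \<in> supp (x i)"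
  shows "i \<le> n"
  using assms(2)
proof (induction i arbitrary: n)
  case (Suc i)
  obtain k where "k \<in> supp (x i)"
    using assms(1) supp_empty_iff unfolding inf_block_seq_def by blast
  then have "i \<le> k" "k < n"
    using Suc assms(1) by (auto simp: inf_block_seq_def precedes_def)
  then show ?case
    by simp
qed simp

lemma block_subspace_UNIV: "block_subspace UNIV"
proof -
  have supp_e: "supp (e n) = {n}" for n
    using representation_basis[of "range e" "e n"] basis_independent basis_inj
    by (simp add: supp_def inj_eq)
  moreover have "e n \<noteq> 0" for n
    using supp_e[of n] supp_empty_iff[of "e n"] by (simp del: supp_empty_iff)
  ultimately have "inf_block_seq e"
    by (simp add: inf_block_seq_def precedes_def)
  then show ?thesis
    using basis_span by (auto simp: block_subspace_def)
qed

text \<open>The blocks \<open>v j\<close> have disjoint supports, so on each of them a vector of the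
  span is a scalar multiple of \<open>v j\<close>. If the scalar is nonzero, the whole block lies in
  the support.\<close>

lemma span_block_supp:
  assumes v: "inf_block_seq v" and x: "x \<in> span (range v)" and n: "n \<in> supp x"
  shows "\<exists>j. n \<in> supp (v j) \<and> supp (v j) \<subseteq> supp x"
proof -
  \<comment> \<open>The conclusion itself does not visibly pass to sums, where blocks may cancel;
    \<open>Q\<close> is stable under linear operations.\<close>
  define Q where "Q = (\<lambda>y. (\<forall>n\<in>supp y. \<exists>j. n \<in> supp (v j)) \<and>
    (\<forall>j. \<exists>c. \<forall>n\<in>supp (v j). coef y n = c * coef (v j) n))"
  have "Q x"
    using x
  proof (induction rule: span_induct)
    case base
    show ?case
      unfolding subspace_def mem_Collect_eq
    proof (intro conjI ballI allI)
      show "Q 0"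
        unfolding Q_def
        by (auto simp: supp_iff representation_zero intro: exI[of _ 0])
    next
      fix y z
      assume "y \<in> Collect Q" "z \<in> Collect Q"
      then have y: "Q y" and z: "Q z"
        by auto
      have "\<exists>j. n \<in> supp (v j)" if "n \<in> supp (y + z)" for n
      proof -
        have "n \<in> supp y \<or> n \<in> supp z"
          using that by (auto simp: supp_iff coef_add)
        then show ?thesis
          using y z by (auto simp: Q_def)
      qed
      moreover have "\<exists>c. \<forall>n\<in>supp (v j). coef (y + z) n = c * coef (v j) n" for j
      proof -
        obtain a b where "\<forall>n\<in>supp (v j). coef y n = a * coef (v j) n"
          "\<forall>n\<in>supp (v j). coef z n = b * coef (v j) n"
          using y z unfolding Q_def by meson
        then show ?thesis
          by (intro exI[of _ "a + b"]) (simp add: coef_add distrib_right)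
      qed
      ultimately show "Q (y + z)"
        by (simp add: Q_def)
    next
      fix a y
      assume "y \<in> Collect Q"
      then have y: "Q y"
        by simp
      have "\<exists>j. n \<in> supp (v j)" if "n \<in> supp (a *s y)" for n
        using that y by (auto simp: Q_def supp_iff coef_scale)
      moreover have "\<exists>c. \<forall>n\<in>supp (v j). coef (a *s y) n = c * coef (v j) n" for j
      proof -
        obtain b where "\<forall>n\<in>supp (v j). coef y n = b * coef (v j) n"
          using y unfolding Q_def by meson
        then show ?thesis
          by (intro exI[of _ "a * b"]) (simp add: coef_scale mult.assoc)
      qed
      ultimately show "Q (a *s y)"
        by (simp add: Q_def)
    qed
  next
    case (step y)
    then obtain i where i: "y = v i"
      by blast
    have "\<exists>c. \<forall>n\<in>supp (v j). coef (v i) n = c * coef (v j) n" for j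
    proof (cases "j = i")
      case True
      then show ?thesis
        by (intro exI[of _ 1]) simp
    next
      case False
      then have "precedes (v i) (v j) \<or> precedes (v j) (v i)"
        using inf_block_seq_precedes[OF v] by (meson linorder_neqE_nat)
      then have "supp (v i) \<inter> supp (v j) = {}"
        by (auto simp: precedes_def)
      then show ?thesis
        by (intro exI[of _ 0]) (auto simp: supp_iff)
    qed
    then show ?case
      by (auto simp: Q_def i)
  qed
  then obtain j where j: "n \<in> supp (v j)"
    using n by (auto simp: Q_def)
  obtain c where c: "\<And>m. m \<in> supp (v j) \<Longrightarrow> coef x m = c * coef (v j) m"
    using \<open>Q x\<close> unfolding Q_def by blast
  then have "c \<noteq> 0"
    using n j by (auto simp: supp_iff)
  then have "supp (v j) \<subseteq> supp x"
    using c by (auto simp: supp_iff)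
  with j show ?thesis
    by blast
qed

section \<open>Sparse block subspaces\<close>

text \<open>A subsequence of the blocks of \<open>W\<close> is chosen so that each gap exceeds the
  value of \<open>f\<close> one past the end of the preceding block. This passes to the span because
  a vector ends where one of its blocks ends, and any later vector uses only later blocks.\<close>

lemma sparse_block_subspace:
  fixes f :: "nat \<Rightarrow> nat"
  assumes "block_subspace W"
  obtains X where "X \<subseteq> W" "block_subspace X" "\<And>x. x \<in> X \<Longrightarrow> nat_precedes (f 0) x"
    "\<And>x y. x \<in> X \<Longrightarrow> y \<in> X \<Longrightarrow> x \<noteq> 0 \<Longrightarrow> precedes x y \<Longrightarrow> nat_precedes (f (Suc (Max (supp x)))) y"
proof -
  obtain w where w: "inf_block_seq w" "W = span (range w)"
    using assms by (auto simp: block_subspace_def)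
  have far: "nat_precedes k (w m)" if "k < m" for k m
    using inf_block_seq_index_le[OF w(1)] that unfolding nat_precedes_def by fastforce
  define g where "g b = f (Suc (Max (supp (w b))))" for b
  have "\<exists>m. \<forall>j. f 0 < m j \<and> m j < m (Suc j) \<and> g (m j) < m (Suc j)"
  proof (rule dependent_nat_choice)
    show "\<exists>a. f 0 < a" by blast
  next
    fix a :: nat and n :: nat
    assume "f 0 < a"
    then show "\<exists>b. f 0 < b \<and> a < b \<and> g a < b"
      by (intro exI[of _ "Suc (a + g a)"]) auto
  qed
  then obtain m where m: "\<And>j. f 0 < m j" "\<And>j. m j < m (Suc j)" "\<And>j. g (m j) < m (Suc j)"
    by blast
  then have mono: "strict_mono m"
    by (simp add: strict_mono_Suc_iff)
  define v where "v j = w (m j)" for j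
  have v: "inf_block_seq v"
    using w(1) m(2) inf_block_seq_precedes[OF w(1)] by (auto simp: inf_block_seq_def v_def)
  have "nat_precedes (f 0) x" if x: "x \<in> span (range v)" for x
    using span_block_supp[OF v x] far[OF m(1)] unfolding nat_precedes_def v_def by blast
  moreover have "nat_precedes (f (Suc (Max (supp x)))) y"
    if x: "x \<in> span (range v)" and y: "y \<in> span (range v)" and x0: "x \<noteq> 0" and xy: "precedes x y"
    for x y
    unfolding nat_precedes_def
  proof
    fix n
    assume n: "n \<in> supp y"
    define p where "p = Max (supp x)"
    have p: "p \<in> supp x"
      using x0 by (simp add: p_def)
    obtain j where j: "p \<in> supp (v j)" "supp (v j) \<subseteq> supp x"
      using span_block_supp[OF v x p] by blast
    obtain k where k: "n \<in> supp (v k)" "supp (v k) \<subseteq> supp y"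
      using span_block_supp[OF v y n] by blast
    \<comment> \<open>The block \<open>v j\<close> ends exactly where \<open>x\<close> ends, so the
      gap after it was chosen to exceed \<open>f (Suc p)\<close>.\<close>
    have "p = Max (supp (v j))"
      using j by (intro Max_eqI[symmetric]) (auto simp: p_def)
    then have gj: "g (m j) = f (Suc p)"
      by (simp add: g_def v_def)
    have "p < n"
      using p n xy by (simp add: precedes_def)
    \<comment> \<open>A common block would lie in both supports, contradicting
      \<open>precedes x y\<close>; an earlier block for \<open>n\<close> would force
      \<open>n < p\<close>.\<close>
    moreover have "j \<noteq> k"
      using p j k xy by (auto simp: precedes_def)
    moreover have "n < p" if "k < j"
      using inf_block_seq_precedes[OF v that] j(1) k(1) by (simp add: precedes_def)
    ultimately have "Suc j \<le> k"
      by (meson Suc_leI less_asym linorder_neqE_nat)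
    then have "g (m j) < m k"
      using m(3)[of j] mono by (meson less_le_trans strict_mono_less_eq)
    then show "f (Suc (Max (supp x))) < n"
      using far k(1) by (simp add: gj p_def[symmetric] nat_precedes_def v_def)
  qed
  moreover have "span (range v) \<subseteq> W"
    unfolding w(2) by (rule span_mono) (auto simp: v_def)
  moreover have "block_subspace (span (range v))"
    using v by (auto simp: block_subspace_def)
  ultimately show thesis
    by (rule that[rotated 2])
qed

section \<open>Defeating a strategy of I by means of largeness\<close>

lemma strategy_I_large_contradiction:
  assumes W: "block_subspace W" and I: "I_strategy_asymptotic W [] (UNIV - A)"
    and \<delta>: "\<And>i. \<delta> i > 0" and large: "large (Int_Delta \<delta> A)"
  shows False
proof -
  obtain \<tau> where \<tau>: "\<And>x. (\<And>i. x i \<in> W \<and> x i \<noteq> 0 \<and> nat_precedes (\<tau> (map x [0..<i])) (x i) \<and>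
      precedes (x i) (x (Suc i))) \<Longrightarrow> [] \<frown> x \<in> UNIV - A"
    using I unfolding I_strategy_asymptotic_def Let_def by blast
  \<comment> \<open>Fixing the exact support ensures that a net vector inherits all order relations
    of the vector it replaces.\<close>
  define D where "D d = {x \<in> W. supp x = d \<and> nrm x \<le> 1}" for d
  have "\<exists>N\<subseteq>D d. finite N \<and> (\<forall>x\<in>D d. \<exists>y\<in>N. nrm (x - y) < \<delta> i)" for i d
  proof (cases "finite d")
    case True
    then show ?thesis
      using \<delta> in_span_supp by (intro finite_net_subset[of "e ` d" _ _ 1]) (auto simp: D_def)
  next
    case False
    then have "D d = {}"
      using finite_supp by (auto simp: D_def)
    then show ?thesis
      by simp
  qed
  then have "\<forall>i d. \<exists>N. N \<subseteq> D d \<and> finite N \<and> (\<forall>x\<in>D d. \<exists>y\<in>N. nrm (x - y) < \<delta> i)"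
    by blast
  then obtain N where N: "\<And>i d. N i d \<subseteq> D d" "\<And>i d. finite (N i d)"
    "\<And>i d x. x \<in> D d \<Longrightarrow> \<exists>y\<in>N i d. nrm (x - y) < \<delta> i"
    unfolding choice_iff by blast
  \<comment> \<open>\<open>M b\<close> collects the net vectors for rounds before \<open>b\<close>
    with support below \<open>b\<close>, and \<open>T b\<close> the positions formed from them. The
    bound \<open>b\<close> on the length suffices because the \<open>i\<close>-th term of a block
    sequence has no support below \<open>i\<close>.\<close>
  define M where "M b = (\<Union>i\<in>{..<b}. \<Union>d\<in>Pow {..<b}. N i d)" for b
  define T where "T b = {ys. set ys \<subseteq> M b \<and> length ys \<le> b}" for b
  have finite_T: "finite (T b)" for b
    unfolding T_def using N(2) by (intro finite_lists_length_le) (simp add: M_def)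
  \<comment> \<open>The gaps of \<open>X\<close> dominate every answer of \<open>\<tau>\<close> to a
    position in \<open>T b\<close>. For the opening move, \<open>T 0\<close> contains just the empty
    position.\<close>
  obtain X where X: "X \<subseteq> W" "block_subspace X" "\<And>x. x \<in> X \<Longrightarrow> nat_precedes (Max (\<tau> ` T 0)) x"
    "\<And>x y. x \<in> X \<Longrightarrow> y \<in> X \<Longrightarrow> x \<noteq> 0 \<Longrightarrow> precedes x y \<Longrightarrow>
      nat_precedes (Max (\<tau> ` T (Suc (Max (supp x))))) y"
    by (rule sparse_block_subspace[OF W, of "\<lambda>b. Max (\<tau> ` T b)"]) (rule that)
  obtain x where x: "x \<in> Int_Delta \<delta> A" "inf_block_seq x" "\<And>i. x i \<in> X" "\<And>i. nrm (x i) \<le> 1"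
    using large X(2) unfolding large_def unit_block_seqs_def by blast
  have "x i \<in> D (supp (x i))" for i
    using x(3,4) X(1) by (auto simp: D_def)
  then have "\<forall>i. \<exists>y. y \<in> N i (supp (x i)) \<and> nrm (x i - y) < \<delta> i"
    using N(3) by blast
  then obtain z where z: "\<And>i. z i \<in> N i (supp (x i))" "\<And>i. nrm (x i - z i) < \<delta> i"
    unfolding choice_iff by blast
  have zD: "z i \<in> W" "supp (z i) = supp (x i)" for i
    using subsetD[OF N(1) z(1)[of i]] by (auto simp: D_def)
  have bound: "nat_precedes (Max (\<tau> ` T b)) (x i) \<Longrightarrow> map z [0..<i] \<in> T b \<Longrightarrow>
    nat_precedes (\<tau> (map z [0..<i])) (z i)" for b i
    using Max_ge[OF finite_imageI[OF finite_T[of b]], of "\<tau> (map z [0..<i])" \<tau>]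
    unfolding nat_precedes_def zD by (meson imageI le_less_trans)
  have prec: "nat_precedes (\<tau> (map z [0..<i])) (z i)" for i
  proof (cases i)
    case 0
    then show ?thesis
      using bound[of 0 0] X(3) x(3) by (simp add: T_def)
  next
    case (Suc k)
    \<comment> \<open>All terms up to round \<open>k\<close> have support below
      \<open>Suc p\<close>, and \<open>k \<le> p\<close>, so the position before round
      \<open>i\<close> belongs to \<open>T (Suc p)\<close>.\<close>
    define p where "p = Max (supp (x k))"
    have xk: "x k \<noteq> 0"
      using x(2) by (simp add: inf_block_seq_def)
    then have p: "p \<in> supp (x k)"
      by (simp add: p_def)
    have kp: "k \<le> p"
      using inf_block_seq_index_le[OF x(2) p] .
    have "supp (x j) \<subseteq> {..<Suc p}" if "j < i" for j
    proof (cases "j = k")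
      case True
      then show ?thesis
        by (auto simp: p_def less_Suc_eq_le)
    next
      case False
      then have "precedes (x j) (x k)"
        using that Suc inf_block_seq_precedes[OF x(2)] by simp
      then show ?thesis
        using p by (auto simp: precedes_def less_Suc_eq)
    qed
    then have "z j \<in> M (Suc p)" if "j < i" for j
      using that z(1)[of j] kp Suc unfolding M_def
      by (intro UN_I[of j] UN_I[of "supp (x j)"]) auto
    then have "map z [0..<i] \<in> T (Suc p)"
      using kp Suc by (auto simp: T_def)
    moreover have "nat_precedes (Max (\<tau> ` T (Suc p))) (x i)"
      using X(4)[of "x k" "x i"] x xk Suc by (simp add: inf_block_seq_def p_def)
    ultimately show ?thesis
      using bound by blast
  qed
  have "precedes (z i) (z (Suc i))" for i
    using x(2) by (simp add: zD inf_block_seq_def precedes_def)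
  moreover have "z i \<noteq> 0" for i
    using x(2) zD(2)[of i] supp_empty_iff unfolding inf_block_seq_def by metis
  ultimately have "z \<notin> A"
    using \<tau>[of z] zD prec by simp
  moreover have "z \<in> A"
    using x(1) z(2) by (simp add: Int_Delta_def)
  ultimately show False
    by blast
qed

lemma strategically_Ramsey_large:
  assumes "strategically_Ramsey A" "\<And>i. \<delta> i > 0" "large (Int_Delta \<delta> A)"
  shows "\<exists>X. block_subspace X \<and> II_strategy_Gowers X [] A"
proof -
  have "fin_block_seq []"
    by (simp add: fin_block_seq_def)
  then obtain W where "block_subspace W"
    "II_strategy_Gowers W [] A \<or> I_strategy_asymptotic W [] (UNIV - A)"
    using assms(1) block_subspace_UNIV unfolding strategically_Ramsey_def by blast
  then show ?thesis
    using strategy_I_large_contradiction assms(2,3) by blast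
qed

end

theorem theorem7:
  fixes scale :: "'f::field \<Rightarrow> 'e::ab_group_add \<Rightarrow> 'e"
    and emb :: "'f \<Rightarrow> complex"
    and e :: "nat \<Rightarrow> 'e"
    and nrm :: "'e \<Rightarrow> real"
    and A :: "(nat \<Rightarrow> 'e) set"
    and \<delta> :: "nat \<Rightarrow> real"
  assumes "normed_space_with_basis scale emb e nrm"
    and "normed_space_with_basis.strategically_Ramsey scale e A"
    and "\<forall>i. \<delta> i > 0"
    and "normed_space_with_basis.large scale e nrm
           (normed_space_with_basis.Int_Delta nrm \<delta> A)"
  shows "\<exists>X. normed_space_with_basis.block_subspace scale e X \<and>
             normed_space_with_basis.II_strategy_Gowers scale e X [] A"
  using normed_space_with_basis.strategically_Ramsey_large[OF assms(1,2) _ assms(4)] assms(3)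
  by blast

end
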